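(* Let $\lambda\in\mathbb{R}$ and let $r\ge 0$ be an integer. For every integer $n\ge 0$, $$\mathcal{E}_{n,\lambda}(r)=\sum_{k=0}^{n}\Big(-\frac{1}{2}\Big)^{k}k!\,{n+r \brace k+r}_{r,\lambda}.$$
   Context: For $\lambda\in\mathbb{R}$ put $(x)_{0,\lambda}=1$, $(x)_{n,\lambda}=x(x-\lambda)\cdots(x-(n-1)\lambda)$ for $n\ge 1$. Also $(x)_0=1$ and $(x)_n=x(x-1)\cdots(x-n+1)$ for $n\ge1$. For an integer $r\ge 0$, the degenerate $r$-Stirling numbers of the second kind ${n+r \brace k+r}_{r,\lambda}$ ($0\le k\le n$) are defined by the polynomial identity in $x$: $(x+r)_{n,\lambda}=\sum_{k=0}^{n}{n+r \brace k+r}_{r,\lambda}(x)_{k}$ for $n\ge 0$. The degenerate exponential functions are the formal power series $e_{\lambda}^{x}(t)=\sum_{n=0}^{\infty}(x)_{n,\lambda}\frac{t^{n}}{n!}$, with $e_\lambda(t)=e_\lambda^1(t)$. The degenerate Euler polynomials $\mathcal{E}_{n,\lambda}(x)$ are defined by the formal power series identity $$\frac{2}{e_{\lambda}(t)+1}e_{\lambda}^{x}(t)=\sum_{n=0}^{\infty}\mathcal{E}_{n,\lambda}(x)\frac{t^{n}}{n!}.$$ *)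

theory Defs
  imports "HOL-Computational_Algebra.Formal_Power_Series"
begin

definition falling_fact :: "real \<Rightarrow> nat \<Rightarrow> real" where
  "falling_fact x n = (\<Prod>i<n. x - real i)"

definition deg_falling_fact :: "real \<Rightarrow> real \<Rightarrow> nat \<Rightarrow> real" where
  "deg_falling_fact lam x n = (\<Prod>i<n. x - real i * lam)"

text \<open>
  The coefficients of the expansion of the polynomial function
  \<open>x \<mapsto> deg_falling_fact lam (x + r) n\<close> in the basis of falling factorials. The predicate pins down
  \<open>c k\<close> for \<open>k > n\<close> to be 0, so that the coefficient sequence is unique
  (lemma \<open>ex1_deg_rstirling2_coeffs\<close>).
\<close>

definition is_deg_rstirling2_coeffs :: "real \<Rightarrow> nat \<Rightarrow> nat \<Rightarrow> (nat \<Rightarrow> real) \<Rightarrow> bool" where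
  "is_deg_rstirling2_coeffs lam r n c \<longleftrightarrow>
     (\<forall>k>n. c k = 0) \<and>
     (\<forall>x. deg_falling_fact lam (x + real r) n = (\<Sum>k=0..n. c k * falling_fact x k))"

text \<open>
  \<open>deg_rstirling2 lam r n k\<close> is the number with upper entry \<open>n + r\<close> and lower entry \<open>k + r\<close>:
  the last two arguments are the unshifted \<open>n\<close> and \<open>k\<close>.
\<close>

definition deg_rstirling2 :: "real \<Rightarrow> nat \<Rightarrow> nat \<Rightarrow> nat \<Rightarrow> real" where
  "deg_rstirling2 lam r n = (THE c. is_deg_rstirling2_coeffs lam r n c)"

definition deg_exp :: "real \<Rightarrow> real \<Rightarrow> real fps" where
  "deg_exp lam x = Abs_fps (\<lambda>n. deg_falling_fact lam x n / fact n)"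

text \<open>
  The denominator has constant coefficient 2, hence is a unit and the division is exact.
\<close>

definition deg_euler :: "real \<Rightarrow> nat \<Rightarrow> real \<Rightarrow> real" where
  "deg_euler lam n x = fact n * fps_nth (2 / (deg_exp lam 1 + 1) * deg_exp lam x) n"

lemma falling_fact_Suc: "falling_fact x (Suc n) = (x - real n) * falling_fact x n"
  by (simp add: falling_fact_def)

lemma falling_fact_of_nat_eq_0: "j < k \<Longrightarrow> falling_fact (real j) k = 0"
  by (auto simp: falling_fact_def)

lemma falling_fact_of_nat_self_nonzero: "falling_fact (real j) j \<noteq> 0"
  by (auto simp: falling_fact_def)

lemma falling_fact_expansion_unique:
  assumes "\<And>x. (\<Sum>k=0..n. d k * falling_fact x k) = 0" and "j \<le> n"
  shows "d j = 0"
  using assms(2)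
proof (induction j rule: less_induct)
  case (less j)
  have "(\<Sum>k=0..n. d k * falling_fact (real j) k)
          = (\<Sum>k\<in>{j}. d k * falling_fact (real j) k)"
  proof (rule sum.mono_neutral_right)
    show "\<forall>i\<in>{0..n} - {j}. d i * falling_fact (real j) i = 0"
    proof
      fix i assume "i \<in> {0..n} - {j}"
      then show "d i * falling_fact (real j) i = 0"
        using less falling_fact_of_nat_eq_0[of j i] by (cases "i < j") auto
    qed
  qed (use less.prems in auto)
  then show ?case
    using assms(1)[of "real j"] falling_fact_of_nat_self_nonzero[of j] by simp
qed

lemma ex_deg_rstirling2_coeffs: "\<exists>c. is_deg_rstirling2_coeffs lam r n c"
proof (induction n)
  case 0
  show ?case
    by (rule exI[of _ "\<lambda>k. if k = 0 then 1 else 0"])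
       (simp add: is_deg_rstirling2_coeffs_def deg_falling_fact_def falling_fact_def)
next
  case (Suc n)
  then obtain c where c0: "\<And>k. k > n \<Longrightarrow> c k = 0"
    and c: "\<And>x. deg_falling_fact lam (x + real r) n = (\<Sum>k=0..n. c k * falling_fact x k)"
    by (auto simp: is_deg_rstirling2_coeffs_def)
  define a where "a k = real k + real r - real n * lam" for k
  define c' where "c' k = (if k = 0 then 0 else c (k - 1)) + a k * c k" for k
  have "deg_falling_fact lam (x + real r) (Suc n)
          = (\<Sum>k=0..Suc n. c' k * falling_fact x k)" for x
  proof -
    have "deg_falling_fact lam (x + real r) (Suc n)
            = (x + real r - real n * lam) * (\<Sum>k=0..n. c k * falling_fact x k)"
      using c[of x] by (simp add: deg_falling_fact_def)
    also have "\<dots> = (\<Sum>k=0..n. c k * falling_fact x (Suc k) + a k * c k * falling_fact x k)"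
      by (simp add: sum_distrib_left falling_fact_Suc a_def algebra_simps)
    also have "\<dots> = (\<Sum>k=0..n. c k * falling_fact x (Suc k))
                     + (\<Sum>k=0..Suc n. a k * c k * falling_fact x k)"
      using c0[of "Suc n"] by (simp add: sum.distrib)
    also have "(\<Sum>k=0..n. c k * falling_fact x (Suc k))
                 = (\<Sum>k=0..Suc n. (if k = 0 then 0 else c (k - 1)) * falling_fact x k)"
      by (subst sum.atLeast0_atMost_Suc_shift) simp
    finally show ?thesis
      by (simp only: c'_def distrib_right sum.distrib)
  qed
  moreover have "c' k = 0" if "k > Suc n" for k
    using that c0[of k] c0[of "k - 1"] by (simp add: c'_def)
  ultimately show ?case
    unfolding is_deg_rstirling2_coeffs_def by blast
qed

lemma ex1_deg_rstirling2_coeffs: "\<exists>!c. is_deg_rstirling2_coeffs lam r n c"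
proof (rule ex_ex1I[OF ex_deg_rstirling2_coeffs])
  fix c d
  assume c: "is_deg_rstirling2_coeffs lam r n c" and d: "is_deg_rstirling2_coeffs lam r n d"
  have "(\<Sum>k=0..n. (c k - d k) * falling_fact x k) = 0" for x
    using c d unfolding is_deg_rstirling2_coeffs_def
    by (simp add: left_diff_distrib sum_subtractf)
  then have "c k - d k = 0" if "k \<le> n" for k
    using falling_fact_expansion_unique[of "\<lambda>k. c k - d k" n k] that by blast
  then show "c = d"
    using c d unfolding is_deg_rstirling2_coeffs_def
    by (metis eq_iff_diff_eq_0 ext linorder_not_less)
qed

lemma is_deg_rstirling2_coeffs_deg_rstirling2:
  "is_deg_rstirling2_coeffs lam r n (deg_rstirling2 lam r n)"
  unfolding deg_rstirling2_def by (rule theI'[OF ex1_deg_rstirling2_coeffs])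

lemma deg_euler_fps:
  "2 / (deg_exp lam 1 + 1) * deg_exp lam x = Abs_fps (\<lambda>n. deg_euler lam n x / fact n)"
  by (rule fps_ext) (simp add: deg_euler_def)

lemma deg_euler_fps_denominator:
  "(2 / (deg_exp lam 1 + 1)) * (deg_exp lam 1 + 1) = (2 :: real fps)"
proof -
  have "fps_nth (deg_exp lam 1 + 1) 0 \<noteq> 0"
    by (simp add: deg_exp_def deg_falling_fact_def)
  then show ?thesis
    by (simp add: fps_divide_unit inverse_mult_eq_1 mult.assoc)
qed

end

theory Submission
  imports Defs
begin

text \<open>
  Write \<open>e = deg_exp lam 1\<close> and \<open>u = e - 1\<close>, a power series without constant term. The theorem is the
  geometric expansion
    \<open>2 / (e + 1) * e ^ r = e ^ r / (1 + u / 2) = (\<Sum>k. (- 1 / 2) ^ k * e ^ r * u ^ k)\<close>,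
  read off at the coefficient of \<open>t ^ n\<close>. Two facts make this reading possible. The degenerate
  exponential turns addition into multiplication (\<open>deg_exp_add\<close>), so that \<open>deg_exp lam r\<close> really is
  \<open>e ^ r\<close>. And \<open>e ^ r * u ^ k / k!\<close> is the exponential generating function of the degenerate
  \<open>r\<close>-Stirling numbers with lower index \<open>k\<close> (\<open>deg_rstirling2_egf\<close>), because expanding
  \<open>e ^ (j + r) = e ^ r * (1 + u) ^ j\<close> binomially gives exactly the defining expansion in falling
  factorials at the point \<open>x = j\<close>. Since \<open>u ^ k\<close> is divisible by \<open>t ^ k\<close>, only the terms with
  \<open>k \<le> n\<close> matter, and finite sums suffice throughout.
\<close>

lemma deg_falling_fact_Suc:
  "deg_falling_fact lam x (Suc n) = (x - real n * lam) * deg_falling_fact lam x n"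
  by (simp add: deg_falling_fact_def)

text \<open>
  The degenerate exponential is \<open>(1 + lam * t) powr (x / lam)\<close>, and this is its differential
  equation in a form that also makes sense for \<open>lam = 0\<close>.
\<close>

lemma deg_exp_ode:
  "(1 + fps_const lam * fps_X) * fps_deriv (deg_exp lam x) = fps_const x * deg_exp lam x"
proof (rule fps_ext)
  fix n
  show "fps_nth ((1 + fps_const lam * fps_X) * fps_deriv (deg_exp lam x)) n
          = fps_nth (fps_const x * deg_exp lam x) n"
    by (cases n)
       (simp_all add: deg_exp_def deg_falling_fact_Suc distrib_right mult.assoc field_simps
          del: of_nat_Suc)
qed

lemma deg_exp_ode_unique:
  fixes F :: "real fps"
  assumes ode: "(1 + fps_const lam * fps_X) * fps_deriv F = fps_const x * F"
    and init: "fps_nth F 0 = 1"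
  shows "F = deg_exp lam x"
proof (rule fps_ext)
  fix n
  show "fps_nth F n = fps_nth (deg_exp lam x) n"
  proof (induction n)
    case 0
    show ?case by (simp add: init deg_exp_def deg_falling_fact_def)
  next
    case (Suc n)
    have "fps_nth ((1 + fps_const lam * fps_X) * fps_deriv F) n = x * fps_nth F n"
      by (simp add: ode)
    then have "real (Suc n) * fps_nth F (Suc n) = (x - real n * lam) * fps_nth F n"
      by (cases n) (simp_all add: distrib_right mult.assoc algebra_simps)
    then have "fps_nth F (Suc n) = (x - real n * lam) * fps_nth F n / real (Suc n)"
      by (simp add: field_simps del: of_nat_Suc)
    then show ?case
      by (simp add: Suc deg_exp_def deg_falling_fact_Suc)
  qed
qed

text \<open>
  The product on the right satisfies the differential equation that determines the left-hand side.
  Comparing coefficients, this is the Vandermonde identity for degenerate falling factorials.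
\<close>

lemma deg_exp_add: "deg_exp lam (x + y) = deg_exp lam x * deg_exp lam y"
proof (rule deg_exp_ode_unique[symmetric])
  let ?A = "deg_exp lam x" and ?B = "deg_exp lam y" and ?c = "1 + fps_const lam * fps_X :: real fps"
  have "?c * fps_deriv (?A * ?B) = (?c * fps_deriv ?A) * ?B + ?A * (?c * fps_deriv ?B)"
    by (simp add: algebra_simps)
  also have "\<dots> = fps_const (x + y) * (?A * ?B)"
    unfolding deg_exp_ode by (simp add: algebra_simps flip: fps_const_add)
  finally show "?c * fps_deriv (?A * ?B) = fps_const (x + y) * (?A * ?B)" .
qed (simp add: deg_exp_def deg_falling_fact_def)

lemma deg_exp_of_nat: "deg_exp lam (real m) = deg_exp lam 1 ^ m"
proof (induction m)
  case 0
  show ?case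
    by (rule deg_exp_ode_unique[symmetric]) simp_all
next
  case (Suc m)
  then show ?case
    by (simp add: deg_exp_add)
qed

lemma fps_nth_mult_power_eq_0:
  fixes f g :: "real fps"
  assumes "fps_nth g 0 = 0" and "n < k"
  shows "fps_nth (f * g ^ k) n = 0"
  using assms by (auto simp: fps_mult_nth startsby_zero_power_prefix intro!: sum.neutral)

lemma falling_fact_of_nat: "falling_fact (real j) k = fact k * real (j choose k)"
  by (simp add: falling_fact_def binomial_gbinomial gbinomial_prod_rev atLeast0LessThan)

text \<open>
  At the point \<open>j\<close> only the terms with \<open>k \<le> j\<close> survive, so the values at the natural numbers
  already form a triangular system for the coefficients.
\<close>

lemma falling_fact_expansion_unique_of_nat:
  assumes eq: "\<And>j::nat. (\<Sum>k=0..n. c k * falling_fact (real j) k)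
                 = (\<Sum>k=0..n. d k * falling_fact (real j) k)"
    and "j \<le> n"
  shows "c j = d j"
  using assms(2)
proof (induction j rule: less_induct)
  case (less j)
  have split: "(\<Sum>k=0..n. a k * falling_fact (real j) k)
          = (\<Sum>k<j. a k * falling_fact (real j) k) + a j * falling_fact (real j) j" for a
  proof -
    have "(\<Sum>k=0..n. a k * falling_fact (real j) k) = (\<Sum>k<Suc j. a k * falling_fact (real j) k)"
      using less.prems by (intro sum.mono_neutral_right) (auto simp: falling_fact_of_nat_eq_0)
    then show ?thesis by simp
  qed
  have "(\<Sum>k<j. c k * falling_fact (real j) k) = (\<Sum>k<j. d k * falling_fact (real j) k)"
    using less by (intro sum.cong) auto
  with eq[of j] show ?case
    by (simp add: split falling_fact_of_nat_self_nonzero)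
qed

text \<open>
  Both sides solve the same interpolation problem: the coefficient of \<open>t ^ n\<close> in
  \<open>e ^ (j + r) = (\<Sum>k. (j choose k) * e ^ r * (e - 1) ^ k)\<close> expands the degenerate falling
  factorial of \<open>j + r\<close> in the falling factorials of \<open>j\<close>.
\<close>

lemma deg_rstirling2_egf:
  assumes "k \<le> n"
  shows "fact k * deg_rstirling2 lam r n k
           = fact n * fps_nth (deg_exp lam (real r) * (deg_exp lam 1 - 1) ^ k) n"
proof -
  define u where "u = deg_exp lam 1 - 1"
  define a where "a k = fps_nth (deg_exp lam (real r) * u ^ k) n" for k
  have u0: "fps_nth u 0 = 0"
    by (simp add: u_def deg_exp_def deg_falling_fact_def)
  have a0: "a k = 0" if "n < k" for k
    unfolding a_def using u0 that by (rule fps_nth_mult_power_eq_0)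
  have "(\<Sum>k=0..n. deg_rstirling2 lam r n k * falling_fact (real j) k)
          = (\<Sum>k=0..n. fact n * a k / fact k * falling_fact (real j) k)" for j
  proof -
    have "deg_exp lam (real j + real r) = deg_exp lam (real r) * (u + 1) ^ j"
      by (simp add: deg_exp_add deg_exp_of_nat u_def mult.commute)
    also have "\<dots> = (\<Sum>k\<le>j. fps_const (real (j choose k)) * (deg_exp lam (real r) * u ^ k))"
      by (simp add: binomial_ring sum_distrib_left fps_of_nat mult_ac)
    finally have "deg_falling_fact lam (real j + real r) n / fact n = (\<Sum>k\<le>j. real (j choose k) * a k)"
      by (simp add: deg_exp_def fps_eq_iff fps_sum_nth a_def)
    \<comment> \<open>Between \<open>j\<close> and \<open>n\<close> the binomial coefficient or \<open>a k\<close> vanishes, so either bound may be used.\<close>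
    also have "\<dots> = (\<Sum>k\<le>max j n. real (j choose k) * a k)"
      by (rule sum.mono_neutral_left) auto
    also have "\<dots> = (\<Sum>k=0..n. real (j choose k) * a k)"
      by (rule sum.mono_neutral_right) (auto simp: a0)
    finally have "deg_falling_fact lam (real j + real r) n
                    = (\<Sum>k=0..n. fact n * a k / fact k * falling_fact (real j) k)"
      by (simp add: falling_fact_of_nat field_simps sum_distrib_left)
    then show ?thesis
      using is_deg_rstirling2_coeffs_deg_rstirling2[of lam r n]
      by (simp add: is_deg_rstirling2_coeffs_def)
  qed
  then have "deg_rstirling2 lam r n k = fact n * a k / fact k"
    using assms by (rule falling_fact_expansion_unique_of_nat)
  then show ?thesis
    by (simp add: a_def u_def)
qed

theorem theorem5:
  fixes lam :: real and r n :: nat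
  shows "deg_euler lam n (real r) = (\<Sum>k=0..n. (- 1 / 2) ^ k * fact k * deg_rstirling2 lam r n k)"
proof -
  define u where "u = deg_exp lam 1 - 1"
  define R where "R = deg_exp lam (real r)"
  define G where "G = 2 / (deg_exp lam 1 + 1) * R"
  \<comment> \<open>\<open>v\<close> is the ratio of the geometric series: \<open>(e + 1) / 2 = 1 - v\<close>.\<close>
  define v where "v = fps_const (- 1 / 2) * u"
  have v0: "fps_nth v 0 = 0"
    by (simp add: v_def u_def deg_exp_def deg_falling_fact_def)
  have half: "fps_const (1 / 2) * (2 :: real fps) = 1"
    by (simp add: numeral_fps_const)
  have "1 - v = fps_const (1 / 2) * (deg_exp lam 1 + 1)"
    by (rule fps_ext) (simp add: v_def u_def field_simps)
  then have "(1 - v) * G = fps_const (1 / 2) * (2 / (deg_exp lam 1 + 1) * (deg_exp lam 1 + 1)) * R"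
    by (simp add: G_def mult_ac)
  then have R: "R = (1 - v) * G"
    by (simp add: deg_euler_fps_denominator half)
  have "(\<Sum>k=0..n. R * v ^ k) = G * ((1 - v) * (\<Sum>k<Suc n. v ^ k))"
    by (simp add: R mult_ac sum_distrib_left atLeast0AtMost lessThan_Suc_atMost)
  also have "\<dots> = G - G * v ^ Suc n"
    by (simp only: one_diff_power_eq[symmetric]) (simp add: right_diff_distrib)
  finally have "fps_nth (\<Sum>k=0..n. R * v ^ k) n = fps_nth G n"
    using fps_nth_mult_power_eq_0[OF v0, of n "Suc n" G] by simp
  then have "deg_euler lam n (real r) = fact n * (\<Sum>k=0..n. fps_nth (R * v ^ k) n)"
    by (simp add: deg_euler_def G_def R_def fps_sum_nth)
  also have "\<dots> = (\<Sum>k=0..n. (- 1 / 2) ^ k * (fact n * fps_nth (R * u ^ k) n))"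
  proof -
    have "R * v ^ k = fps_const ((- 1 / 2) ^ k) * (R * u ^ k)" for k
      by (simp add: v_def power_mult_distrib fps_const_power mult_ac)
    then have "fps_nth (R * v ^ k) n = (- 1 / 2) ^ k * fps_nth (R * u ^ k) n" for k
      by (simp only: fps_mult_left_const_nth)
    then show ?thesis
      by (simp only: sum_distrib_left mult.left_commute)
  qed
  also have "\<dots> = (\<Sum>k=0..n. (- 1 / 2) ^ k * fact k * deg_rstirling2 lam r n k)"
    by (rule sum.cong) (simp_all add: deg_rstirling2_egf R_def u_def mult.assoc)
  finally show ?thesis .
qed

end
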